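(* Let $f:\mathbb{R}\to\mathbb{R}$ be a locally integrable function (a fixed pointwise representative of an element of $L^1_{\mathrm{loc}}(\mathbb{R})$) and let $x_0\in\mathbb{R}$. If the first symmetric Borel derivative $SBD^{1}f(x_0)$ exists finitely, say $SBD^{1}f(x_0)=L$, then for every even $\phi\in\mathcal{D}(\mathbb{R})$, \[ \lim_{\varepsilon\to 0^+}\langle T_f',\phi_{x_0,\varepsilon}\rangle =L\int_{\mathbb{R}}\phi(u)\,du. \] In particular, $T_f'$ has symmetric distributional point value $L$ at $x_0$.
   Context: $\mathcal{D}(\mathbb{R})=C_c^\infty(\mathbb{R})$ and $\mathcal{D}'(\mathbb{R})$ is the space of distributions. For $f\in L^1_{\mathrm{loc}}(\mathbb{R})$, $T_f\in\mathcal{D}'(\mathbb{R})$ is the regular distribution $\langle T_f,\psi\rangle=\int_{\mathbb{R}} f\psi\,dx$, and its distributional derivative is $\langle T_f',\psi\rangle=-\langle T_f,\psi'\rangle$. For $\phi\in\mathcal{D}(\mathbb{R})$ and $\varepsilon>0$, $\phi_{x_0,\varepsilon}(x)=\varepsilon^{-1}\phi\left(\frac{x-x_0}{\varepsilon}\right)$. The first symmetric Borel derivative of $f$ at $x_0$ is \[ SBD^{1}f(x_0)=\lim_{h\to 0^+}\frac{1}{h}\int_0^h \frac{f(x_0+t)-f(x_0-t)}{2t}\,dt, \] whenever this limit exists finitely (in particular the integrand is Lebesgue integrable on $(0,h)$ for all sufficiently small $h>0$). A distribution $T$ has symmetric distributional point value $L\in\mathbb{R}$ at $x_0$ if $\lim_{\varepsilon\to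 0^+}\langle T,\phi_{x_0,\varepsilon}\rangle=L\int_{\mathbb{R}}\phi(u)\,du$ for every even $\phi\in\mathcal{D}(\mathbb{R})$. *)

theory Defs
  imports "HOL-Analysis.Analysis"
begin

definition fun_support :: "(real \<Rightarrow> real) \<Rightarrow> real set" where
  "fun_support \<phi> = closure {x. \<phi> x \<noteq> 0}"

definition smooth_fun :: "(real \<Rightarrow> real) \<Rightarrow> bool" where
  "smooth_fun \<phi> \<longleftrightarrow> (\<forall>n. (deriv ^^ n) \<phi> differentiable_on UNIV)"

definition test_functions :: "(real \<Rightarrow> real) set" where
  "test_functions = {\<phi>. smooth_fun \<phi> \<and> compact (fun_support \<phi>)}"

text \<open>
  A functional is modelled as a total HOL function on \<open>real \<Rightarrow> real\<close>; only its values on test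
  functions matter. Continuity on \<open>test_functions\<close> is expressed by the usual seminorm
  estimates on the test functions supported in a fixed compact set; the suprema are finite
  because these functions and their derivatives are continuous with compact support.
\<close>

definition distribution :: "((real \<Rightarrow> real) \<Rightarrow> real) \<Rightarrow> bool" where
  "distribution T \<longleftrightarrow>
     (\<forall>\<phi>\<in>test_functions. \<forall>\<psi>\<in>test_functions. T (\<lambda>x. \<phi> x + \<psi> x) = T \<phi> + T \<psi>) \<and>
     (\<forall>c. \<forall>\<phi>\<in>test_functions. T (\<lambda>x. c * \<phi> x) = c * T \<phi>) \<and>
     (\<forall>K. compact K \<longrightarrow>
        (\<exists>C N. \<forall>\<phi>\<in>test_functions. fun_support \<phi> \<subseteq> K \<longrightarrow>
           \<bar>T \<phi>\<bar> \<le> C * (\<Sum>k\<le>(N::nat). SUP x. \<bar>(deriv ^^ k) \<phi> x\<bar>)))"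

definition locally_integrable :: "(real \<Rightarrow> real) \<Rightarrow> bool" where
  "locally_integrable f \<longleftrightarrow> (\<forall>K. compact K \<longrightarrow> set_integrable lebesgue K f)"

definition regular_distribution :: "(real \<Rightarrow> real) \<Rightarrow> (real \<Rightarrow> real) \<Rightarrow> real" where
  "regular_distribution f \<psi> = (LINT x|lebesgue. f x * \<psi> x)"

definition distributional_deriv :: "((real \<Rightarrow> real) \<Rightarrow> real) \<Rightarrow> (real \<Rightarrow> real) \<Rightarrow> real" where
  "distributional_deriv T \<psi> = - T (deriv \<psi>)"

definition rescaled :: "(real \<Rightarrow> real) \<Rightarrow> real \<Rightarrow> real \<Rightarrow> real \<Rightarrow> real" where
  "rescaled \<phi> x0 \<epsilon> = (\<lambda>x. (1 / \<epsilon>) * \<phi> ((x - x0) / \<epsilon>))"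

definition has_symmetric_Borel_derivative :: "(real \<Rightarrow> real) \<Rightarrow> real \<Rightarrow> real \<Rightarrow> bool" where
  \<comment> \<open>Integrability is required explicitly: the Lebesgue integral of a non-integrable function
      is 0 by convention.\<close>
  "has_symmetric_Borel_derivative f L x0 \<longleftrightarrow>
     (\<forall>\<^sub>F h in at_right 0.
        set_integrable lebesgue {0<..<h} (\<lambda>t. (f (x0 + t) - f (x0 - t)) / (2 * t))) \<and>
     ((\<lambda>h. (1 / h) * (LINT t:{0<..<h}|lebesgue. (f (x0 + t) - f (x0 - t)) / (2 * t)))
        \<longlongrightarrow> L) (at_right 0)"

definition even_fun :: "(real \<Rightarrow> real) \<Rightarrow> bool" where
  "even_fun \<phi> \<longleftrightarrow> (\<forall>x. \<phi> (- x) = \<phi> x)"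

definition has_symmetric_point_value ::
    "((real \<Rightarrow> real) \<Rightarrow> real) \<Rightarrow> real \<Rightarrow> real \<Rightarrow> bool" where
  "has_symmetric_point_value T L x0 \<longleftrightarrow>
     distribution T \<and>
     (\<forall>\<phi>\<in>test_functions. even_fun \<phi> \<longrightarrow>
        ((\<lambda>\<epsilon>. T (rescaled \<phi> x0 \<epsilon>)) \<longlongrightarrow> L * (LINT u|lebesgue. \<phi> u)) (at_right 0))"

end

(*
  Write q(t) = (f(x0+t) - f(x0-t)) / (2t). As phi' is odd, a change of variables turns
  <T_f', phi_{x0,e}> into - int_0^R q(e u) Psi(u) du with Psi(u) = 2 u phi'(u), and for q = L this
  is L int phi. The hypothesis says that the primitives int_0^s (q(e u) - L) du tend to 0 uniformly
  for s <= R. Integrating by parts against them moves the derivative to the smooth factor Psi, so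
  only these primitives and a bound for Psi' on [0,R] are needed.
*)
theory Submission
  imports Defs
begin

section \<open>Test functions: derivatives and support\<close>

lemma test_function_DERIV:
  assumes "\<phi> \<in> test_functions"
  shows "((deriv ^^ n) \<phi> has_real_derivative (deriv ^^ Suc n) \<phi> x) (at x)"
proof -
  have "(deriv ^^ n) \<phi> differentiable at x"
    using assms by (auto simp: test_functions_def smooth_fun_def differentiable_on_def)
  then show ?thesis
    by (simp add: DERIV_deriv_iff_real_differentiable)
qed

text \<open>The complement of the support is open, so \<open>\<phi>\<close> vanishes on a whole
  neighbourhood of \<open>x\<close>, not only at \<open>x\<close>.\<close>

lemma test_function_deriv_eq_0:
  assumes "x \<notin> fun_support \<phi>"
  shows "deriv \<phi> x = 0"
proof (rule DERIV_imp_deriv)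
  have "\<forall>\<^sub>F y in nhds x. y \<in> - fun_support \<phi>"
    using assms by (intro eventually_nhds_in_open) (auto simp: fun_support_def)
  then have "\<forall>\<^sub>F y in nhds x. \<phi> y = 0"
    by eventually_elim (use closure_subset in \<open>force simp: fun_support_def\<close>)
  then show "(\<phi> has_real_derivative 0) (at x)"
    using DERIV_cong_ev[of x x \<phi> "\<lambda>_. 0" 0 0] by simp
qed

lemma continuous_test_function_deriv:
  assumes "\<phi> \<in> test_functions"
  shows "continuous_on S ((deriv ^^ n) \<phi>)"
  using test_function_DERIV[OF assms] DERIV_isCont by (intro continuous_at_imp_continuous_on) blast

section \<open>The derivative of \<open>f\<close> as a distribution of order at most one\<close>

text \<open>A continuous \<open>g\<close> is bounded on the compact \<open>K\<close>, hence on
  \<open>S\<close>, and a bounded measurable factor preserves integrability. Keeping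
  \<open>S\<close> and \<open>K\<close> apart allows \<open>S\<close> to be an open
  interval.\<close>

lemma set_integrable_mult_continuous:
  fixes f g :: "real \<Rightarrow> real"
  assumes "set_integrable lebesgue S f" "S \<in> sets lebesgue"
    and K: "compact K" "S \<subseteq> K" "continuous_on K g"
  shows "set_integrable lebesgue S (\<lambda>x. f x * g x)"
proof -
  have "bounded (g ` S)"
    using K compact_imp_bounded[OF compact_continuous_image] by (blast intro: bounded_subset)
  then have "(\<lambda>x. g x * f x) absolutely_integrable_on S"
    using assms continuous_on_subset
    by (intro absolutely_integrable_bounded_measurable_product_real
        continuous_imp_measurable_on_sets_lebesgue) auto
  then show ?thesis by (simp add: mult.commute)
qed

text \<open>The factor \<open>deriv \<phi>\<close> vanishes off the compact support, so
  integrability over that set, which local integrability of \<open>f\<close> provides, is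
  integrability over the line.\<close>

lemma integrable_mult_test_function_deriv:
  assumes "locally_integrable f" "\<phi> \<in> test_functions"
  shows "integrable lebesgue (\<lambda>x. f x * deriv \<phi> x)"
proof -
  let ?K = "fun_support \<phi>"
  have K: "compact ?K" using assms by (auto simp: test_functions_def)
  have "set_integrable lebesgue ?K (\<lambda>x. f x * deriv \<phi> x)"
    using assms K continuous_test_function_deriv[of \<phi> _ 1]
    lmeasurable_compact[OF K]
    by (intro set_integrable_mult_continuous[where K = ?K]) (auto simp: locally_integrable_def)
  moreover have "(\<lambda>x. indicator ?K x *\<^sub>R (f x * deriv \<phi> x)) = (\<lambda>x. f x * deriv \<phi> x)"
  proof
    show "indicator ?K x *\<^sub>R (f x * deriv \<phi> x) = f x * deriv \<phi> x" for x
      using test_function_deriv_eq_0[of x \<phi>] by (cases "x \<in> ?K") auto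
  qed
  ultimately show ?thesis by (simp only: set_integrable_def)
qed

text \<open>A real \<open>SUP\<close> is an upper bound only for a set that is bounded above, so
  this must precede any use of the seminorms. Orders 0 and 1 are those in the estimate for the
  derivative of \<open>f\<close>.\<close>

lemma bounded_test_function_deriv:
  assumes "\<phi> \<in> test_functions" "n \<le> 1"
  shows "bdd_above (range (\<lambda>x. \<bar>(deriv ^^ n) \<phi> x\<bar>))"
proof -
  let ?K = "fun_support \<phi>"
  have "compact ((deriv ^^ n) \<phi> ` ?K)"
    using assms continuous_test_function_deriv
    by (intro compact_continuous_image) (auto simp: test_functions_def)
  then obtain B where B: "\<bar>(deriv ^^ n) \<phi> x\<bar> \<le> B" if "x \<in> ?K" for x
    by (fastforce dest: compact_imp_bounded simp: bounded_iff)
  have "(deriv ^^ n) \<phi> x = 0" if "x \<notin> ?K" for x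
  proof (cases n)
    case 0
    then show ?thesis using that closure_subset by (force simp: fun_support_def)
  next
    case (Suc m)
    then show ?thesis using that assms test_function_deriv_eq_0 by simp
  qed
  then have "\<bar>(deriv ^^ n) \<phi> x\<bar> \<le> max B 0" for x
    using B[of x] by (cases "x \<in> ?K") auto
  then show ?thesis by (auto simp: bdd_above_def)
qed

text \<open>On test functions supported in \<open>K\<close>, the value is at most the integral of
  \<open>\<bar>f\<bar>\<close> over \<open>K\<close> times the supremum of
  \<open>\<bar>deriv \<phi>\<bar>\<close>. A symmetric point value is defined for distributions
  only, so this is one half of that claim.\<close>

lemma distribution_distributional_deriv:
  assumes f: "locally_integrable f"
  shows "distribution (distributional_deriv (regular_distribution f))"
proof -
  let ?T = "distributional_deriv (regular_distribution f)"
  have T: "?T \<phi> = - (LINT x|lebesgue. f x * deriv \<phi> x)" for \<phi>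
    by (simp add: distributional_deriv_def regular_distribution_def)
  note int = integrable_mult_test_function_deriv[OF f]
  note D = test_function_DERIV[where n = 0, simplified]
  have "?T (\<lambda>x. \<phi> x + \<psi> x) = ?T \<phi> + ?T \<psi>"
    if "\<phi> \<in> test_functions" "\<psi> \<in> test_functions" for \<phi> \<psi>
  proof -
    have "deriv (\<lambda>x. \<phi> x + \<psi> x) = (\<lambda>x. deriv \<phi> x + deriv \<psi> x)"
      using DERIV_add[OF D[OF that(1)] D[OF that(2)]] by (intro ext DERIV_imp_deriv)
    then show ?thesis using int that by (simp add: T distrib_left)
  qed
  moreover have "?T (\<lambda>x. c * \<phi> x) = c * ?T \<phi>" if "\<phi> \<in> test_functions" for c \<phi>
  proof -
    have "deriv (\<lambda>x. c * \<phi> x) = (\<lambda>x. c * deriv \<phi> x)"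
      using DERIV_cmult[OF D[OF that]] by (intro ext DERIV_imp_deriv)
    then show ?thesis by (simp add: T mult.left_commute)
  qed
  moreover have "\<exists>C N. \<forall>\<phi>\<in>test_functions. fun_support \<phi> \<subseteq> K \<longrightarrow>
      \<bar>?T \<phi>\<bar> \<le> C * (\<Sum>k\<le>(N::nat). SUP x. \<bar>(deriv ^^ k) \<phi> x\<bar>)" if K: "compact K" for K
  \<comment> \<open>Both witnesses are fixed by the last \<open>show\<close>: \<open>C\<close> is
    the integral of \<open>\<bar>f\<bar>\<close> over \<open>K\<close>, and \<open>N = 1\<close>.
    Neither depends on \<open>\<phi>\<close>.\<close>
  proof (intro exI ballI impI)
    fix \<phi> assume \<phi>: "\<phi> \<in> test_functions" and supp: "fun_support \<phi> \<subseteq> K"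
    define S where "S k = (SUP x. \<bar>(deriv ^^ k) \<phi> x\<bar>)" for k
    have S: "\<bar>(deriv ^^ k) \<phi> x\<bar> \<le> S k" if "k \<le> 1" for k x
      unfolding S_def using bounded_test_function_deriv[OF \<phi> that] by (intro cSUP_upper) auto
    have fK: "integrable lebesgue (\<lambda>x. indicator K x * \<bar>f x\<bar>)"
      using f K set_integrable_abs[of lebesgue K f]
      by (auto simp: locally_integrable_def set_integrable_def)
    have "\<bar>?T \<phi>\<bar> \<le> (LINT x|lebesgue. \<bar>f x * deriv \<phi> x\<bar>)"
      by (simp add: T)
    also have "\<dots> \<le> (LINT x|lebesgue. indicator K x * \<bar>f x\<bar> * S 1)"
    proof (rule integral_mono)
      fix x
      show "\<bar>f x * deriv \<phi> x\<bar> \<le> indicator K x * \<bar>f x\<bar> * S 1"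
      proof (cases "x \<in> K")
        case True
        then show ?thesis using S[of 1 x] by (auto simp: abs_mult intro: mult_left_mono)
      next
        case False
        then have "deriv \<phi> x = 0" using supp by (intro test_function_deriv_eq_0) auto
        then show ?thesis using False by simp
      qed
    qed (use int[OF \<phi>] fK in auto)
    also have "\<dots> = (LINT x|lebesgue. indicator K x * \<bar>f x\<bar>) * S 1" by simp
    \<comment> \<open>The definition asks for the sum of all seminorms up to \<open>N\<close>; the
      extra term \<open>S 0\<close> is nonnegative.\<close>
    also have "\<dots> \<le> (LINT x|lebesgue. indicator K x * \<bar>f x\<bar>) * (\<Sum>k\<le>1. S k)"
      using S[of 0 0] by (intro mult_left_mono integral_nonneg_AE) auto
    finally show "\<bar>?T \<phi>\<bar> \<le> (LINT x|lebesgue. indicator K x * \<bar>f x\<bar>) *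
        (\<Sum>k\<le>1. SUP x. \<bar>(deriv ^^ k) \<phi> x\<bar>)"
      by (simp only: S_def)
  qed
  ultimately show ?thesis unfolding distribution_def by blast
qed

section \<open>Integration by parts through Fubini\<close>

text \<open>The intervals \<open>{- real n..real n}\<close> exhaust the line. This makes Fubini
  available for products with \<open>lebesgue\<close> as a factor.\<close>

lemma sigma_finite_lebesgue: "sigma_finite_measure (lebesgue :: real measure)"
proof
  show "\<exists>A. countable A \<and> A \<subseteq> sets (lebesgue :: real measure) \<and> \<Union> A = space lebesgue \<and>
      (\<forall>a\<in>A. emeasure lebesgue a \<noteq> \<infinity>)"
  proof (intro exI conjI)
    let ?A = "range (\<lambda>n. {- real n..real n})"
    show "countable ?A" "?A \<subseteq> sets (lebesgue :: real measure)"
      "\<forall>a\<in>?A. emeasure lebesgue a \<noteq> \<infinity>"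
      by (auto simp: emeasure_completion)
    have "\<exists>n::nat. x \<in> {- real n..real n}" for x :: real
      using real_arch_simple[of "\<bar>x\<bar>"] by (force simp: abs_le_iff)
    then show "\<Union> ?A = space (lebesgue :: real measure)" by auto
  qed
qed

text \<open>
  An integration by parts: \<open>\<Psi> t\<close> is written as minus the integral of \<open>w\<close> over
  \<open>{t<..<R}\<close>, and Fubini's theorem puts the derivative on \<open>\<Psi>\<close> and the primitive on \<open>q\<close>.
\<close>

lemma set_integral_mult_bound_by_primitive:
  fixes q \<Psi> w :: "real \<Rightarrow> real"
  assumes q: "set_integrable lebesgue {0<..<R} q" and "0 \<le> R" and "0 \<le> C"
    and \<Psi>: "\<And>x. (\<Psi> has_real_derivative w x) (at x)" "\<Psi> R = 0"
    and w: "continuous_on UNIV w" "\<And>x. x \<in> {0..R} \<Longrightarrow> \<bar>w x\<bar> \<le> C"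
    and Q: "\<And>s. s \<in> {0<..<R} \<Longrightarrow> \<bar>LINT t:{0<..<s}|lebesgue. q t\<bar> \<le> D"
  shows "\<bar>LINT t:{0<..<R}|lebesgue. q t * \<Psi> t\<bar> \<le> C * D * R"
proof -
  interpret l: sigma_finite_measure "lebesgue :: real measure" by (rule sigma_finite_lebesgue)
  \<comment> \<open>The factors differ on purpose: \<open>q\<close> is only Lebesgue measurable,
    while \<open>w\<close> is continuous and its integral is evaluated by the fundamental theorem of
    calculus over \<open>lborel\<close>.\<close>
  interpret P: pair_sigma_finite "lebesgue :: real measure" "lborel :: real measure" ..
  define q' where "q' t = indicator {0<..<R} t * q t" for t
  define w' where "w' u = indicator {0<..<R} u * w u" for u
  have [measurable]: "w \<in> borel_measurable borel"
    using w(1) by (rule borel_measurable_continuous_onI)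
  have q': "integrable lebesgue q'"
    using q by (simp add: set_integrable_def q'_def[abs_def])
  then have [measurable]: "q' \<in> borel_measurable lebesgue" by simp
  have [measurable]: "w' \<in> borel_measurable borel" unfolding w'_def by measurable
  have wC: "\<bar>w' u\<bar> \<le> C * indicator {0<..<R} u" for u
    using w(2) by (auto simp: w'_def indicator_def)
  have w': "integrable lborel w'"
    by (rule Bochner_Integration.integrable_bound[where f = "\<lambda>u. C * indicator {0<..<R} u"])
      (use wC \<open>0 \<le> C\<close> \<open>0 \<le> R\<close> in \<open>auto simp: abs_mult\<close>)
  \<comment> \<open>The kernel lives on the triangle \<open>0 < t < u < R\<close>. Integrating over
    \<open>u\<close> first gives \<open>- q t * \<Psi> t\<close>; integrating over \<open>t\<close>
    first gives \<open>w u\<close> times the primitive of \<open>q\<close> at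
    \<open>u\<close>.\<close>
  define k where "k t u = q' t * w' u * indicator {0<..} (u - t)" for t u
  \<comment> \<open>The condition \<open>t < u\<close> is Borel; it stays measurable when the first
    factor is completed because Borel sets are Lebesgue measurable.\<close>
  have m_fst: "(fst :: real \<times> real \<Rightarrow> real) \<in> borel_measurable (lebesgue \<Otimes>\<^sub>M lborel)"
    by (rule measurable_compose[OF measurable_fst]) (simp add: measurable_completion)
  have m_snd: "(snd :: real \<times> real \<Rightarrow> real) \<in> borel_measurable (lebesgue \<Otimes>\<^sub>M lborel)"
    by simp
  have [measurable]: "(\<lambda>z. indicator {0<..} (snd z - fst z) :: real)
      \<in> borel_measurable (lebesgue \<Otimes>\<^sub>M (lborel :: real measure))"
    by (rule measurable_compose[OF borel_measurable_diff[OF m_snd m_fst]]) measurable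
  \<comment> \<open>A product of two integrable functions of separate variables is integrable, and
    it dominates the kernel.\<close>
  have prod: "integrable (lebesgue \<Otimes>\<^sub>M lborel) (\<lambda>(t, u). q' t * w' u)"
    by (rule P.Fubini_integrable) (use q' w' in \<open>auto simp: abs_mult\<close>)
  have k: "integrable (lebesgue \<Otimes>\<^sub>M lborel) (\<lambda>(t, u). k t u)"
  proof (rule Bochner_Integration.integrable_bound[OF prod])
    show "(\<lambda>(t, u). k t u) \<in> borel_measurable (lebesgue \<Otimes>\<^sub>M lborel)"
      unfolding k_def case_prod_unfold by measurable
  qed (auto simp: k_def indicator_def)
  have inner_u: "(LINT u|lborel. k t u) = - (indicator {0<..<R} t * (q t * \<Psi> t))" for t
  proof (cases "t \<in> {0<..<R}")
    case True
    have "(LINT u|lborel. k t u) = q t * (LINT u|lborel. indicator {t..R} u *\<^sub>R w u)"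
    proof -
      have "(LINT u|lborel. k t u) = (LINT u|lborel. q t * (indicator {t..R} u *\<^sub>R w u))"
      proof (rule integral_cong_AE)
        \<comment> \<open>The kernel carries the open interval, the fundamental theorem the closed
          one; they differ in the null set of the points \<open>t\<close> and
          \<open>R\<close>.\<close>
        show "AE u in lborel. k t u = q t * (indicator {t..R} u *\<^sub>R w u)"
          using AE_lborel_singleton[of t] AE_lborel_singleton[of R]
          by eventually_elim (use True in \<open>auto simp: k_def q'_def w'_def indicator_def\<close>)
      qed (auto simp: k_def)
      then show ?thesis by simp
    qed
    also have "(LINT u|lborel. indicator {t..R} u *\<^sub>R w u) = \<Psi> R - \<Psi> t"
      using True \<Psi>(1) w(1)
      by (intro integral_FTC_Icc)
        (auto intro: has_field_derivative_at_within continuous_on_subset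
           simp: has_real_derivative_iff_has_vector_derivative[symmetric])
    finally show ?thesis using True \<Psi>(2) by simp
  qed (auto simp: k_def q'_def)
  have inner_t: "(LINT t|lebesgue. k t u) = w' u * (LINT t:{0<..<u}|lebesgue. q t)" for u
  proof (cases "u \<in> {0<..<R}")
    case True
    then have "k t u = w' u * (indicator {0<..<u} t *\<^sub>R q t)" for t
      by (auto simp: k_def q'_def indicator_def)
    then show ?thesis by (simp add: set_lebesgue_integral_def)
  qed (auto simp: k_def w'_def)
  have "(LINT t:{0<..<R}|lebesgue. q t * \<Psi> t) = - (LINT t|lebesgue. LINT u|lborel. k t u)"
    by (simp add: inner_u set_lebesgue_integral_def)
  also have "\<dots> = - (LINT u|lborel. LINT t|lebesgue. k t u)"
    by (simp add: P.Fubini_integral[OF k])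
  finally have "\<bar>LINT t:{0<..<R}|lebesgue. q t * \<Psi> t\<bar> = \<bar>LINT u|lborel. LINT t|lebesgue. k t u\<bar>"
    by simp
  also have "\<dots> \<le> (LINT u|lborel. \<bar>LINT t|lebesgue. k t u\<bar>)"
    by simp
  also have "\<dots> \<le> (LINT u|lborel. indicator {0<..<R} u * (C * D))"
  proof (rule integral_mono)
    show "integrable lborel (\<lambda>u. \<bar>LINT t|lebesgue. k t u\<bar>)"
      using P.integrable_snd[OF k] by simp
    show "integrable lborel (\<lambda>u. indicator {0<..<R} u * (C * D))"
      using \<open>0 \<le> R\<close> by simp
    show "\<bar>LINT t|lebesgue. k t u\<bar> \<le> indicator {0<..<R} u * (C * D)" for u
    proof (cases "u \<in> {0<..<R}")
      case True
      then show ?thesis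
        using wC[of u] Q[of u] \<open>0 \<le> C\<close> by (auto simp: inner_t abs_mult intro!: mult_mono)
    qed (auto simp: inner_t w'_def)
  qed
  also have "\<dots> = C * D * R" using \<open>0 \<le> R\<close> by simp
  finally show ?thesis .
qed

section \<open>Reflection and scaling of Lebesgue integrals\<close>

text \<open>The point 0 is null, and the reflection \<open>x \<mapsto> - x\<close> carries the
  negative half-line to the positive one. With an odd weight, this folding is what produces
  symmetric differences of \<open>f\<close>.\<close>

lemma integral_eq_integral_even_part:
  fixes h :: "real \<Rightarrow> real"
  assumes h: "integrable lebesgue h"
  shows "(LINT x|lebesgue. h x) = (LINT x:{0<..}|lebesgue. h x + h (- x))"
proof -
  have h': "integrable lebesgue (\<lambda>x. h (- x))"
    using lebesgue_integrable_real_affine_iff[of "-1" h 0] h by simp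
  have pos: "set_integrable lebesgue {0<..} h" "set_integrable lebesgue {0<..} (\<lambda>x. h (- x))"
    using h h' unfolding set_integrable_def by (intro integrable_mult_indicator; simp)+
  have neg: "set_integrable lebesgue {..<0} h"
    using h unfolding set_integrable_def by (intro integrable_mult_indicator; simp)
  have "(LINT x|lebesgue. h x) = (LINT x|lebesgue. indicator {0<..} x *\<^sub>R h x + indicator {..<0} x *\<^sub>R h x)"
  proof (rule integral_cong_AE)
    have "AE x in lebesgue. x \<noteq> (0::real)"
      using AE_lborel_singleton[of "0::real"] by (rule AE_completion)
    then show "AE x in lebesgue. h x = indicator {0<..} x *\<^sub>R h x + indicator {..<0} x *\<^sub>R h x"
      by eventually_elim (auto simp: indicator_def)
  qed (use h pos neg in \<open>auto simp: set_integrable_def\<close>)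
  also have "\<dots> = (LINT x:{0<..}|lebesgue. h x) + (LINT x:{..<0}|lebesgue. h x)"
    using pos neg by (simp add: set_integrable_def set_lebesgue_integral_def)
  also have "(LINT x:{..<0}|lebesgue. h x) = (LINT x:{0<..}|lebesgue. h (- x))"
    using lebesgue_integral_real_affine[of "-1" "\<lambda>x. indicator {..<0} x *\<^sub>R h x" 0]
    by (simp add: set_lebesgue_integral_def indicator_def)
  finally show ?thesis using pos by simp
qed

lemma integrable_compact_support:
  fixes g :: "real \<Rightarrow> real"
  assumes "continuous_on UNIV g" "\<And>x. R \<le> \<bar>x\<bar> \<Longrightarrow> g x = 0"
  shows "integrable lebesgue g"
proof -
  have "(\<lambda>x. indicator {-R..R} x *\<^sub>R g x) = g"
  proof
    show "indicator {-R..R} x *\<^sub>R g x = g x" for x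
      using assms(2)[of x] by (cases "x \<in> {-R..R}") auto
  qed
  moreover have "integrable lborel (\<lambda>x. indicator {-R..R} x *\<^sub>R g x)"
    using assms(1) by (intro borel_integrable_compact) (auto intro: continuous_on_subset)
  ultimately show ?thesis by (simp add: integrable_completion)
qed

text \<open>The affine image of a compact set is compact, and its indicator composed with the affine
  map is the indicator of \<open>K\<close>.\<close>

lemma locally_integrable_affine:
  assumes f: "locally_integrable f" and "c \<noteq> 0"
  shows "locally_integrable (\<lambda>x. f (t + c * x))"
  unfolding locally_integrable_def
proof (intro allI impI)
  fix K :: "real set" assume "compact K"
  let ?K = "(\<lambda>x. t + c * x) ` K"
  have "compact ?K"
    using \<open>compact K\<close> by (intro compact_continuous_image continuous_intros)
  then have "integrable lebesgue (\<lambda>x. indicator ?K x *\<^sub>R f x)"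
    using f by (auto simp: locally_integrable_def set_integrable_def)
  then have "integrable lebesgue (\<lambda>x. indicator ?K (t + c * x) *\<^sub>R f (t + c * x))"
    by (rule iffD2[OF lebesgue_integrable_real_affine_iff[OF \<open>c \<noteq> 0\<close>,
          of "\<lambda>x. indicator ?K x *\<^sub>R f x"]])
  moreover have "indicator ?K (t + c * x) = (indicator K x :: real)" for x
    using \<open>c \<noteq> 0\<close> by (auto simp: indicator_def)
  ultimately show "set_integrable lebesgue K (\<lambda>x. f (t + c * x))"
    by (simp only: set_integrable_def)
qed

text \<open>The map \<open>t \<mapsto> e * t\<close> takes \<open>{0<..<s}\<close> onto
  \<open>{0<..<e * s}\<close>. This turns primitives of a scaled quotient into the means of the
  Borel derivative at \<open>h = e * s\<close>.\<close>

lemma scaled_interval: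
  fixes g :: "real \<Rightarrow> real"
  assumes "0 < e"
  shows set_integrable_scaled_interval:
      "set_integrable lebesgue {0<..<s} (\<lambda>t. g (e * t)) \<longleftrightarrow> set_integrable lebesgue {0<..<e * s} g"
    and set_integral_scaled_interval:
      "(LINT t:{0<..<s}|lebesgue. g (e * t)) = (1 / e) * (LINT t:{0<..<e * s}|lebesgue. g t)"
proof -
  have ind: "indicator {0<..<e * s} (e * t) = (indicator {0<..<s} t :: real)" for t
    using assms by (auto simp: indicator_def zero_less_mult_iff)
  show "set_integrable lebesgue {0<..<s} (\<lambda>t. g (e * t)) \<longleftrightarrow> set_integrable lebesgue {0<..<e * s} g"
    using lebesgue_integrable_real_affine_iff[of e "\<lambda>t. indicator {0<..<e * s} t *\<^sub>R g t" 0] assms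
    by (simp add: set_integrable_def ind)
  show "(LINT t:{0<..<s}|lebesgue. g (e * t)) = (1 / e) * (LINT t:{0<..<e * s}|lebesgue. g t)"
    using lebesgue_integral_real_affine[of e "\<lambda>t. indicator {0<..<e * s} t *\<^sub>R g t" 0] assms
    by (simp add: set_lebesgue_integral_def ind)
qed

section \<open>Pairings with even test functions as integrals over \<open>{0<..<R}\<close>\<close>

lemma even_fun_deriv_minus:
  assumes "\<phi> \<in> test_functions" "even_fun \<phi>"
  shows "deriv \<phi> (- x) = - deriv \<phi> x"
proof -
  have "(\<lambda>x. \<phi> (- x)) = \<phi>" using assms(2) by (auto simp: even_fun_def)
  then have "(\<phi> has_real_derivative - deriv \<phi> (- x)) (at x)"
    using test_function_DERIV[OF assms(1), of 0 "- x"] DERIV_mirror[of \<phi> "deriv \<phi> (- x)" x] by simp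
  then show ?thesis by (metis DERIV_imp_deriv minus_minus)
qed

text \<open>The support has the strict bound \<open>\<bar>x\<bar> < R\<close>, so both functions
  vanish at \<open>R\<close> and \<open>- R\<close> as well. That removes the boundary terms
  later.\<close>

lemma test_function_support_bound:
  assumes "\<phi> \<in> test_functions"
  obtains R where "0 < R" "\<And>x. R \<le> \<bar>x\<bar> \<Longrightarrow> \<phi> x = 0" "\<And>x. R \<le> \<bar>x\<bar> \<Longrightarrow> deriv \<phi> x = 0"
proof -
  have "bounded (fun_support \<phi>)"
    using assms by (auto simp: test_functions_def compact_imp_bounded)
  then obtain R where "0 < R" and R: "\<And>x. x \<in> fun_support \<phi> \<Longrightarrow> \<bar>x\<bar> < R"
    by (auto simp: bounded_pos_less)
  show thesis
  proof
    fix x assume "R \<le> \<bar>x\<bar>"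
    then have "x \<notin> fun_support \<phi>" using R[of x] by auto
    then show "\<phi> x = 0" "deriv \<phi> x = 0"
      using closure_subset[of "{x. \<phi> x \<noteq> 0}"] test_function_deriv_eq_0[of x \<phi>]
      by (auto simp: fun_support_def)
  qed fact
qed

text \<open>Differentiating the rescaled function gives the factor \<open>1 / e\<^sup>2\<close>, and
  substituting \<open>x = x0 + e * u\<close> gives back one factor \<open>e\<close>. The remaining
  \<open>1 / e\<close> becomes part of the difference quotient.\<close>

lemma distributional_deriv_rescaled:
  assumes f: "locally_integrable f" and \<phi>: "\<phi> \<in> test_functions" "even_fun \<phi>"
    and R: "\<And>x. R \<le> \<bar>x\<bar> \<Longrightarrow> deriv \<phi> x = 0" and e: "0 < e"
  shows "distributional_deriv (regular_distribution f) (rescaled \<phi> x0 e) =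
    - (LINT u:{0<..<R}|lebesgue. (f (x0 + e * u) - f (x0 - e * u)) / (2 * (e * u)) * (2 * u * deriv \<phi> u))"
proof -
  define h where "h u = f (x0 + e * u) * deriv \<phi> u" for u
  have h: "integrable lebesgue h"
    unfolding h_def using f \<phi> e
    by (intro integrable_mult_test_function_deriv locally_integrable_affine) auto
  have "(rescaled \<phi> x0 e has_real_derivative (1 / e\<^sup>2) * deriv \<phi> ((x - x0) / e)) (at x)" for x
    unfolding rescaled_def using e
    by (auto intro!: derivative_eq_intros DERIV_chain2[OF test_function_DERIV[OF \<phi>(1), of 0, simplified]]
        simp: power2_eq_square field_simps)
  then have "deriv (rescaled \<phi> x0 e) = (\<lambda>x. (1 / e\<^sup>2) * deriv \<phi> ((x - x0) / e))"
    by (intro ext DERIV_imp_deriv)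
  then have "distributional_deriv (regular_distribution f) (rescaled \<phi> x0 e) =
      - (LINT x|lebesgue. f x * ((1 / e\<^sup>2) * deriv \<phi> ((x - x0) / e)))"
    by (simp add: distributional_deriv_def regular_distribution_def)
  also have "\<dots> = - (e * (LINT u|lebesgue. (1 / e\<^sup>2) * h u))"
    using e lebesgue_integral_real_affine[of e "\<lambda>x. f x * ((1 / e\<^sup>2) * deriv \<phi> ((x - x0) / e))" x0]
    by (simp add: h_def mult.commute)
  also have "\<dots> = - (1 / e * (LINT u:{0<..}|lebesgue. h u + h (- u)))"
    using e integral_eq_integral_even_part[OF h] by (simp add: power2_eq_square field_simps)
  also have "\<dots> = - (LINT u:{0<..}|lebesgue. 1 / e * (h u + h (- u)))"
    by (simp only: set_integral_mult_right)
  also have "\<dots> = - (LINT u:{0<..<R}|lebesgue.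
      (f (x0 + e * u) - f (x0 - e * u)) / (2 * (e * u)) * (2 * u * deriv \<phi> u))"
    unfolding set_lebesgue_integral_def
  proof (intro arg_cong[where f = uminus] Bochner_Integration.integral_cong refl)
    fix u
    \<comment> \<open>Since \<open>deriv \<phi>\<close> is odd, \<open>h u + h (- u)\<close> is the
      symmetric difference of \<open>f\<close> times \<open>deriv \<phi> u\<close>. Dividing and
      multiplying by \<open>2 * u\<close> completes the quotient; points \<open>u \<ge> R\<close>
      contribute nothing.\<close>
    show "indicator {0<..} u *\<^sub>R (1 / e * (h u + h (- u))) = indicator {0<..<R} u *\<^sub>R
        ((f (x0 + e * u) - f (x0 - e * u)) / (2 * (e * u)) * (2 * u * deriv \<phi> u))"
      using e R[of u] even_fun_deriv_minus[OF \<phi>, of u]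
      by (cases "0 < u"; cases "u < R") (auto simp: h_def field_simps)
  qed
  finally show ?thesis .
qed

text \<open>The derivative of \<open>u * \<phi> u\<close> is
  \<open>\<phi> u + u * deriv \<phi> u\<close>, and its integral over \<open>{-R..R}\<close>
  vanishes. The term \<open>u * deriv \<phi> u\<close> is even and folds onto the positive
  half-line.\<close>

lemma integral_even_test_function:
  assumes \<phi>: "\<phi> \<in> test_functions" "even_fun \<phi>" and "0 < R"
    and R: "\<And>x. R \<le> \<bar>x\<bar> \<Longrightarrow> \<phi> x = 0" "\<And>x. R \<le> \<bar>x\<bar> \<Longrightarrow> deriv \<phi> x = 0"
  shows "(LINT u|lebesgue. \<phi> u) = - (LINT u:{0<..<R}|lebesgue. 2 * u * deriv \<phi> u)"
proof -
  define h where "h u = u * deriv \<phi> u" for u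
  note D = test_function_DERIV[OF \<phi>(1), of 0, simplified]
  have cont: "continuous_on S \<phi>" "continuous_on S (deriv \<phi>)" for S
    using continuous_test_function_deriv[OF \<phi>(1), of _ 0]
      continuous_test_function_deriv[OF \<phi>(1), of _ 1] by simp_all
  have int: "integrable lebesgue \<phi>" "integrable lebesgue h"
    unfolding h_def using cont R by (auto intro!: integrable_compact_support[of _ R] continuous_intros)
  have "(LINT u|lebesgue. \<phi> u) + (LINT u|lebesgue. h u) = (LINT u|lebesgue. \<phi> u + h u)"
    using int by simp
  also have "\<dots> = (LINT u|lborel. indicator {-R..R} u *\<^sub>R (\<phi> u + h u))"
  proof -
    have "(\<lambda>u. indicator {-R..R} u *\<^sub>R (\<phi> u + h u)) = (\<lambda>u. \<phi> u + h u)"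
    proof
      show "indicator {-R..R} u *\<^sub>R (\<phi> u + h u) = \<phi> u + h u" for u
        using R[of u] by (cases "u \<in> {-R..R}") (auto simp: h_def)
    qed
    moreover have "(\<lambda>u. \<phi> u + h u) \<in> borel_measurable lborel"
      unfolding h_def using cont
      by (auto intro!: borel_measurable_continuous_onI continuous_intros)
    ultimately show ?thesis by (simp only: integral_completion)
  qed
  also have "\<dots> = R * \<phi> R - (- R) * \<phi> (- R)"
    unfolding h_def using \<open>0 < R\<close> cont
    by (intro integral_FTC_Icc)
      (auto intro!: derivative_eq_intros continuous_intros DERIV_subset[OF D]
         simp: has_real_derivative_iff_has_vector_derivative[symmetric])
  also have "\<dots> = 0" using R[of R] R[of "- R"] by simp
  finally have "(LINT u|lebesgue. \<phi> u) = - (LINT u:{0<..}|lebesgue. h u + h (- u))"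
    using integral_eq_integral_even_part[OF int(2)] by simp
  also have "(LINT u:{0<..}|lebesgue. h u + h (- u)) = (LINT u:{0<..<R}|lebesgue. 2 * u * deriv \<phi> u)"
    unfolding set_lebesgue_integral_def
  proof (intro Bochner_Integration.integral_cong refl)
    fix u
    show "indicator {0<..} u *\<^sub>R (h u + h (- u)) = indicator {0<..<R} u *\<^sub>R (2 * u * deriv \<phi> u)"
      using R(2)[of u] even_fun_deriv_minus[OF \<phi>, of u]
      by (cases "0 < u"; cases "u < R") (auto simp: h_def)
  qed
  finally show ?thesis .
qed

section \<open>Passage to the limit\<close>

text \<open>The hypothesis controls the means of the quotient, not its pointwise values, so the
  limit cannot simply be taken under the integral; the estimate goes through primitives
  instead.\<close>

lemma distributional_deriv_rescaled_tendsto: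
  assumes f: "locally_integrable f" and SBD: "has_symmetric_Borel_derivative f L x0"
    and \<phi>: "\<phi> \<in> test_functions" "even_fun \<phi>"
  shows "((\<lambda>\<epsilon>. distributional_deriv (regular_distribution f) (rescaled \<phi> x0 \<epsilon>))
            \<longlongrightarrow> L * (LINT u|lebesgue. \<phi> u)) (at_right 0)"
proof (rule tendstoI)
  fix \<eta> :: real assume "0 < \<eta>"
  obtain R where "0 < R" and R: "\<And>x. R \<le> \<bar>x\<bar> \<Longrightarrow> \<phi> x = 0" "\<And>x. R \<le> \<bar>x\<bar> \<Longrightarrow> deriv \<phi> x = 0"
    using test_function_support_bound[OF \<phi>(1)] by blast
  define q where "q t = (f (x0 + t) - f (x0 - t)) / (2 * t)" for t
  define \<Psi> where "\<Psi> u = 2 * u * deriv \<phi> u" for u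
  define w where "w u = 2 * deriv \<phi> u + 2 * u * deriv (deriv \<phi>) u" for u
  have cont: "continuous_on S (deriv \<phi>)" "continuous_on S (deriv (deriv \<phi>))" for S
    using continuous_test_function_deriv[OF \<phi>(1), of _ 1]
      continuous_test_function_deriv[OF \<phi>(1), of _ 2] by (simp_all add: numeral_2_eq_2)
  have \<Psi>: "(\<Psi> has_real_derivative w x) (at x)" for x
    unfolding \<Psi>_def w_def
    by (auto intro!: derivative_eq_intros test_function_DERIV[OF \<phi>(1), of 1, simplified])
  have w: "continuous_on S w" for S
    unfolding w_def by (intro continuous_intros cont)
  have "bounded (w ` {0..R})"
    by (intro compact_imp_bounded compact_continuous_image w) simp
  then obtain C where "0 < C" and C: "\<And>x. x \<in> {0..R} \<Longrightarrow> \<bar>w x\<bar> \<le> C"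
    by (auto simp: bounded_pos)
  \<comment> \<open>Chosen so that the final bound \<open>C * (R * \<delta>) * R\<close> equals
    \<open>\<eta> / 2\<close>, which leaves room for strict inequality.\<close>
  define \<delta> where "\<delta> = \<eta> / (2 * C * R * R)"
  have "0 < \<delta>" using \<open>0 < \<eta>\<close> \<open>0 < C\<close> \<open>0 < R\<close> by (simp add: \<delta>_def)
  have "\<forall>\<^sub>F h in at_right 0. set_integrable lebesgue {0<..<h} q \<and>
      dist ((1 / h) * (LINT t:{0<..<h}|lebesgue. q t)) L < \<delta>"
    using SBD \<open>0 < \<delta>\<close> unfolding has_symmetric_Borel_derivative_def q_def
    by (auto intro: eventually_conj tendstoD)
  then obtain b where "0 < b"
    and b: "\<And>h. 0 < h \<Longrightarrow> h < b \<Longrightarrow> set_integrable lebesgue {0<..<h} q"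
      "\<And>h. 0 < h \<Longrightarrow> h < b \<Longrightarrow> \<bar>(1 / h) * (LINT t:{0<..<h}|lebesgue. q t) - L\<bar> < \<delta>"
    by (auto simp: eventually_at_right_field dist_real_def)
  \<comment> \<open>For such \<open>e\<close>, every \<open>e * s\<close> with
    \<open>0 < s \<le> R\<close> lies below \<open>b\<close>, so a single threshold serves all
    primitives at once.\<close>
  have "\<forall>\<^sub>F e in at_right 0. 0 < e \<and> e < b / R"
    using \<open>0 < b\<close> \<open>0 < R\<close> by (intro eventually_at_rightI[of 0 "b / R"]) auto
  then show "\<forall>\<^sub>F e in at_right 0. dist (distributional_deriv (regular_distribution f)
      (rescaled \<phi> x0 e)) (L * (LINT u|lebesgue. \<phi> u)) < \<eta>"
  proof eventually_elim
    fix e assume "0 < e \<and> e < b / R"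
    then have e: "0 < e" "e * R < b" using \<open>0 < R\<close> by (auto simp: field_simps)
    let ?qe = "\<lambda>u. q (e * u) - L"
    have const: "set_integrable lebesgue {0<..<s} (\<lambda>_. L)" for s :: real
      by (intro absolutely_integrable_on_const) simp
    have qe: "set_integrable lebesgue {0<..<s} (\<lambda>u. q (e * u))" if "0 < s" "s \<le> R" for s
    proof -
      have "e * s < b" using that e mult_left_mono[of s R e] by linarith
      then have "set_integrable lebesgue {0<..<e * s} q" using that e by (intro b(1)) auto
      then show ?thesis using e by (simp only: set_integrable_scaled_interval)
    qed
    \<comment> \<open>After scaling, the primitive at \<open>s\<close> is \<open>s\<close> times the
      deviation from \<open>L\<close> of the mean over \<open>{0<..<e * s}\<close>; here
      \<open>s < R\<close> and the deviation is below \<open>\<delta>\<close>.\<close>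
    have Q: "\<bar>LINT u:{0<..<s}|lebesgue. ?qe u\<bar> \<le> R * \<delta>" if "s \<in> {0<..<R}" for s
    proof -
      have s: "0 < s" "s < R" "0 < e * s" using that e by auto
      have "e * s < b" using s e mult_left_mono[of s R e] by linarith
      have "(LINT u:{0<..<s}|lebesgue. ?qe u) = (LINT u:{0<..<s}|lebesgue. q (e * u)) - s * L"
        using s qe[of s] const[of s] by (simp add: set_integral_diff(2)) (simp add: set_lebesgue_integral_def)
      also have "\<dots> = s * ((1 / (e * s)) * (LINT u:{0<..<e * s}|lebesgue. q u) - L)"
        unfolding set_integral_scaled_interval[OF e(1), of s q] using s e by (simp add: field_simps)
      finally have "\<bar>LINT u:{0<..<s}|lebesgue. ?qe u\<bar> =
          s * \<bar>(1 / (e * s)) * (LINT u:{0<..<e * s}|lebesgue. q u) - L\<bar>"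
        using s by (simp add: abs_mult)
      also have "\<dots> \<le> R * \<delta>"
        using s b(2)[OF s(3) \<open>e * s < b\<close>] by (intro mult_mono) auto
      finally show ?thesis .
    qed
    have int: "set_integrable lebesgue {0<..<R} (\<lambda>u. g u * \<Psi> u)"
      if "set_integrable lebesgue {0<..<R} g" for g
      using that cont(1)
      by (intro set_integrable_mult_continuous[where K = "{0..R}"])
        (auto simp: \<Psi>_def[abs_def] intro!: continuous_intros)
    \<comment> \<open>Both terms are integrals against the same weight \<open>\<Psi>\<close>, one of
      the scaled quotient and one of the constant \<open>L\<close>, so the error is an integral of
      their difference.\<close>
    have "distributional_deriv (regular_distribution f) (rescaled \<phi> x0 e) - L * (LINT u|lebesgue. \<phi> u) =
        - (LINT u:{0<..<R}|lebesgue. q (e * u) * \<Psi> u) + L * (LINT u:{0<..<R}|lebesgue. \<Psi> u)"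
      unfolding q_def \<Psi>_def
      using distributional_deriv_rescaled[OF f \<phi>, of R e x0] e(1) R(2)
        integral_even_test_function[OF \<phi> \<open>0 < R\<close>] R by auto
    also have "\<dots> = - ((LINT u:{0<..<R}|lebesgue. q (e * u) * \<Psi> u)
        - (LINT u:{0<..<R}|lebesgue. L * \<Psi> u))"
      by simp
    also have "\<dots> = - (LINT u:{0<..<R}|lebesgue. ?qe u * \<Psi> u)"
      using int[OF qe[of R]] int[OF const] \<open>0 < R\<close>
      by (simp add: set_integral_diff(2)[symmetric] left_diff_distrib)
    finally have "\<bar>distributional_deriv (regular_distribution f) (rescaled \<phi> x0 e)
        - L * (LINT u|lebesgue. \<phi> u)\<bar> = \<bar>LINT u:{0<..<R}|lebesgue. ?qe u * \<Psi> u\<bar>"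
      by simp
    also have "\<dots> \<le> C * (R * \<delta>) * R"
      using \<open>0 < R\<close> \<open>0 < C\<close> C Q \<Psi> w R(2)[of R] qe[of R] const
      by (intro set_integral_mult_bound_by_primitive[where w = w] set_integral_diff(1)) (auto simp: \<Psi>_def[of R])
    also have "\<dots> = \<eta> / 2"
      using \<open>0 < C\<close> \<open>0 < R\<close> by (simp add: \<delta>_def field_simps)
    finally show "dist (distributional_deriv (regular_distribution f) (rescaled \<phi> x0 e))
        (L * (LINT u|lebesgue. \<phi> u)) < \<eta>"
      using \<open>0 < \<eta>\<close> by (simp add: dist_real_def)
  qed
qed

theorem theorem3p7:
  fixes f :: "real \<Rightarrow> real" and x0 L :: real
  assumes "locally_integrable f"
    and "has_symmetric_Borel_derivative f L x0"
  shows "(\<forall>\<phi>\<in>test_functions. even_fun \<phi> \<longrightarrow>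
            ((\<lambda>\<epsilon>. distributional_deriv (regular_distribution f) (rescaled \<phi> x0 \<epsilon>))
               \<longlongrightarrow> L * (LINT u|lebesgue. \<phi> u)) (at_right 0))
         \<and> has_symmetric_point_value (distributional_deriv (regular_distribution f)) L x0"
  using distributional_deriv_rescaled_tendsto[OF assms] distribution_distributional_deriv[OF assms(1)]
  by (auto simp: has_symmetric_point_value_def)

end
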